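(* Let $n$ be a positive integer and let $\varphi$ be a formula in the language $\mathcal{L}$ which is true in the strong-contact algebra $PSC^n$ of polytopes in $\mathbb{R}^n$. Then $\varphi$ is a theorem of the formal system $\mathfrak{F}$.
   Context: **The algebra $PSC^n$.** $\mathbb{R}^n$ carries its usual topology. A basic polytope in $\mathbb{R}^n$ is a set $\mathrm{Cl}(\mathrm{Int}(\alpha_1\cap\dots\cap\alpha_k))$ with $\alpha_1,\dots,\alpha_k$ finitely many closed half-spaces of $\mathbb{R}^n$; a polytope is a finite union of basic polytopes. $P^n$ is the set of polytopes; with complement $A^*=\mathrm{Cl}(\mathbb{R}^n\setminus A)$ and join $\cup$ it is a Boolean algebra $\mathcal{P}^n$ (zero $\emptyset$, unit $\mathbb{R}^n$). For $A,B\subseteq\mathbb{R}^n$, $SC^{\mathbb{R}^n}(A,B)$ holds iff there is a connected open set $E\subseteq A\cup B$ with $E\cap A\ne\emptyset$ and $E\cap B\ne\emptyset$. $PSC^n=\langle\mathcal{P}^n,SC^{\mathbb{R}^n}\rangle$. **The language $\mathcal{L}$.** A countable set of individual variables; equality $\equiv$; connectives $\neg,\vee$; a unary function symbol $-$ and a binary function symbol $+$; a binary predicate symbol $C$. Terms are built from variables by $-$ and $+$. Formulas (quantifier-free) are built from atomic formulas $a\equiv b$, $C(a,b)$ ($a,b$ terms) by $\neg,\vee$. Abbreviations: the usual $\wedge,\Rightarrow,\Leftrightarrow$; $a\cdot b$ is $-((-a)+(-b))$; $0$ is $a\cdot(-a)$ (for a term $a$); $1$ is $-0$; $a\not\equiv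 b$ is $\neg(a\equiv b)$. **The system $\mathfrak{F}$.** Only rule: modus ponens. Axiom schemes, for all terms $a,b,c$: (1) a complete set of schemes for classical propositional logic; (2) schemes for equality (reflexivity, symmetry, transitivity, congruence with respect to $-,+,C$) and for Boolean algebras (associativity, commutativity, absorption and distributivity of $+$ and $\cdot$; $a+(-a)\equiv 1$, $a\cdot(-a)\equiv 0$; $0\not\equiv 1$); (3) $\neg C(0,a)$; $C(a,b+c)\Leftrightarrow(C(a,b)\vee C(a,c))$; $C(a,b)\Rightarrow C(b,a)$; $a\not\equiv 0\Rightarrow C(a,a)$; (4) $a\not\equiv 0\Rightarrow(a\not\equiv 1\Rightarrow C(a,-a))$. **Truth.** In a Boolean algebra equipped with a binary relation, $-$ and $+$ are interpreted as complement and join, $C$ as the relation, $\equiv$ as equality. A formula is true in the structure iff it is true under every valuation of the variables by elements of the carrier. *)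

theory Defs
  imports "HOL-Analysis.Analysis"
begin

section \<open>The quantifier-free language\<close>

datatype trm =
    Var nat
  | Compl trm
  | Join trm trm  (infixl "\<^bold>+" 85)

datatype fm =
    Eq trm trm  (infix "\<^bold>=" 80)
  | Con trm trm
  | Neg fm
  | Or fm fm  (infixr "\<^bold>\<or>" 70)

abbreviation Meet :: "trm \<Rightarrow> trm \<Rightarrow> trm"  (infixl "\<^bold>\<cdot>" 90) where
  "a \<^bold>\<cdot> b \<equiv> Compl (Compl a \<^bold>+ Compl b)"

text \<open>The constants are not primitive: zero is \<open>d \<cdot> (-d)\<close> for some term \<open>d\<close>.  The term is
  kept as a parameter, and every axiom scheme mentioning zero or one holds for all choices of it.\<close>

abbreviation Zero :: "trm \<Rightarrow> trm" where
  "Zero d \<equiv> d \<^bold>\<cdot> Compl d"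

abbreviation One :: "trm \<Rightarrow> trm" where
  "One d \<equiv> Compl (Zero d)"

abbreviation Neq :: "trm \<Rightarrow> trm \<Rightarrow> fm"  (infix "\<^bold>\<noteq>" 80) where
  "a \<^bold>\<noteq> b \<equiv> Neg (a \<^bold>= b)"

abbreviation And :: "fm \<Rightarrow> fm \<Rightarrow> fm"  (infixr "\<^bold>\<and>" 75) where
  "A \<^bold>\<and> B \<equiv> Neg (Neg A \<^bold>\<or> Neg B)"

abbreviation Imp :: "fm \<Rightarrow> fm \<Rightarrow> fm"  (infixr "\<^bold>\<Rightarrow>" 65) where
  "A \<^bold>\<Rightarrow> B \<equiv> Neg A \<^bold>\<or> B"

abbreviation Iff :: "fm \<Rightarrow> fm \<Rightarrow> fm"  (infix "\<^bold>\<Leftrightarrow>" 60) where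
  "A \<^bold>\<Leftrightarrow> B \<equiv> (A \<^bold>\<Rightarrow> B) \<^bold>\<and> (B \<^bold>\<Rightarrow> A)"


section \<open>The formal system\<close>

text \<open>Classical propositional logic: the three Lukasiewicz schemes for implication and negation
  together with the introduction and elimination schemes for disjunction.\<close>

inductive prop_axiom :: "fm \<Rightarrow> bool" where
  K: "prop_axiom (A \<^bold>\<Rightarrow> B \<^bold>\<Rightarrow> A)"
| S: "prop_axiom ((A \<^bold>\<Rightarrow> B \<^bold>\<Rightarrow> D) \<^bold>\<Rightarrow> (A \<^bold>\<Rightarrow> B) \<^bold>\<Rightarrow> A \<^bold>\<Rightarrow> D)"
| Contrapos: "prop_axiom ((Neg A \<^bold>\<Rightarrow> Neg B) \<^bold>\<Rightarrow> B \<^bold>\<Rightarrow> A)"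
| OrI1: "prop_axiom (A \<^bold>\<Rightarrow> A \<^bold>\<or> B)"
| OrI2: "prop_axiom (B \<^bold>\<Rightarrow> A \<^bold>\<or> B)"
| OrE: "prop_axiom ((A \<^bold>\<Rightarrow> D) \<^bold>\<Rightarrow> (B \<^bold>\<Rightarrow> D) \<^bold>\<Rightarrow> A \<^bold>\<or> B \<^bold>\<Rightarrow> D)"

inductive eq_axiom :: "fm \<Rightarrow> bool" where
  Refl: "eq_axiom (a \<^bold>= a)"
| Sym: "eq_axiom (a \<^bold>= b \<^bold>\<Rightarrow> b \<^bold>= a)"
| Trans: "eq_axiom (a \<^bold>= b \<^bold>\<Rightarrow> b \<^bold>= c \<^bold>\<Rightarrow> a \<^bold>= c)"
| Cong_Compl: "eq_axiom (a \<^bold>= b \<^bold>\<Rightarrow> Compl a \<^bold>= Compl b)"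
| Cong_Join: "eq_axiom (a \<^bold>= b \<^bold>\<Rightarrow> c \<^bold>= d \<^bold>\<Rightarrow> a \<^bold>+ c \<^bold>= b \<^bold>+ d)"
| Cong_Con: "eq_axiom (a \<^bold>= b \<^bold>\<Rightarrow> c \<^bold>= d \<^bold>\<Rightarrow> Con a c \<^bold>\<Rightarrow> Con b d)"

inductive ba_axiom :: "fm \<Rightarrow> bool" where
  Join_Assoc: "ba_axiom ((a \<^bold>+ b) \<^bold>+ c \<^bold>= a \<^bold>+ (b \<^bold>+ c))"
| Meet_Assoc: "ba_axiom ((a \<^bold>\<cdot> b) \<^bold>\<cdot> c \<^bold>= a \<^bold>\<cdot> (b \<^bold>\<cdot> c))"
| Join_Comm: "ba_axiom (a \<^bold>+ b \<^bold>= b \<^bold>+ a)"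
| Meet_Comm: "ba_axiom (a \<^bold>\<cdot> b \<^bold>= b \<^bold>\<cdot> a)"
| Join_Absorb: "ba_axiom (a \<^bold>+ (a \<^bold>\<cdot> b) \<^bold>= a)"
| Meet_Absorb: "ba_axiom (a \<^bold>\<cdot> (a \<^bold>+ b) \<^bold>= a)"
| Join_Distrib: "ba_axiom (a \<^bold>+ (b \<^bold>\<cdot> c) \<^bold>= (a \<^bold>+ b) \<^bold>\<cdot> (a \<^bold>+ c))"
| Meet_Distrib: "ba_axiom (a \<^bold>\<cdot> (b \<^bold>+ c) \<^bold>= (a \<^bold>\<cdot> b) \<^bold>+ (a \<^bold>\<cdot> c))"
| Join_Compl: "ba_axiom (a \<^bold>+ Compl a \<^bold>= One d)"
| Meet_Compl: "ba_axiom (a \<^bold>\<cdot> Compl a \<^bold>= Zero d)"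
| Zero_One: "ba_axiom (Zero d \<^bold>\<noteq> One d)"

inductive contact_axiom :: "fm \<Rightarrow> bool" where
  Con_Zero: "contact_axiom (Neg (Con (Zero d) a))"
| Con_Join: "contact_axiom (Con a (b \<^bold>+ c) \<^bold>\<Leftrightarrow> Con a b \<^bold>\<or> Con a c)"
| Con_Sym: "contact_axiom (Con a b \<^bold>\<Rightarrow> Con b a)"
| Con_Refl: "contact_axiom (a \<^bold>\<noteq> Zero d \<^bold>\<Rightarrow> Con a a)"
| Con_Connected: "contact_axiom (a \<^bold>\<noteq> Zero d \<^bold>\<Rightarrow> a \<^bold>\<noteq> One d \<^bold>\<Rightarrow> Con a (Compl a))"

inductive F_theorem :: "fm \<Rightarrow> bool" where
  Prop: "prop_axiom A \<Longrightarrow> F_theorem A"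
| Equality: "eq_axiom A \<Longrightarrow> F_theorem A"
| Boolean: "ba_axiom A \<Longrightarrow> F_theorem A"
| Contact: "contact_axiom A \<Longrightarrow> F_theorem A"
| MP: "F_theorem (A \<^bold>\<Rightarrow> B) \<Longrightarrow> F_theorem A \<Longrightarrow> F_theorem B"


section \<open>Truth in a structure\<close>

text \<open>Only the symbols of the language are recorded; zero, one and meet of the Boolean algebra
  are determined by complement and join.\<close>

record 'b contact_structure =
  elems :: "'b set"
  compl_op :: "'b \<Rightarrow> 'b"
  join_op :: "'b \<Rightarrow> 'b \<Rightarrow> 'b"
  contact_rel :: "'b \<Rightarrow> 'b \<Rightarrow> bool"

primrec trm_val :: "'b contact_structure \<Rightarrow> (nat \<Rightarrow> 'b) \<Rightarrow> trm \<Rightarrow> 'b" where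
  "trm_val M v (Var x) = v x"
| "trm_val M v (Compl a) = compl_op M (trm_val M v a)"
| "trm_val M v (a \<^bold>+ b) = join_op M (trm_val M v a) (trm_val M v b)"

primrec holds :: "'b contact_structure \<Rightarrow> (nat \<Rightarrow> 'b) \<Rightarrow> fm \<Rightarrow> bool" where
  "holds M v (a \<^bold>= b) \<longleftrightarrow> trm_val M v a = trm_val M v b"
| "holds M v (Con a b) \<longleftrightarrow> contact_rel M (trm_val M v a) (trm_val M v b)"
| "holds M v (Neg A) \<longleftrightarrow> \<not> holds M v A"
| "holds M v (A \<^bold>\<or> B) \<longleftrightarrow> holds M v A \<or> holds M v B"

definition true_in :: "'b contact_structure \<Rightarrow> fm \<Rightarrow> bool" where
  "true_in M A \<longleftrightarrow> (\<forall>v. (\<forall>x. v x \<in> elems M) \<longrightarrow> holds M v A)"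


section \<open>The strong-contact algebra of polytopes\<close>

definition closed_halfspace :: "'a::euclidean_space set \<Rightarrow> bool" where
  "closed_halfspace H \<longleftrightarrow> (\<exists>a b. a \<noteq> 0 \<and> H = {x. a \<bullet> x \<le> b})"

text \<open>These polytopes may be unbounded and non-convex, unlike those of the library constant
  \<open>polytope\<close> (convex hulls of finite sets).\<close>

definition basic_polytope :: "'a::euclidean_space set \<Rightarrow> bool" where
  "basic_polytope A \<longleftrightarrow>
    (\<exists>\<H>. finite \<H> \<and> \<H> \<noteq> {} \<and> (\<forall>H\<in>\<H>. closed_halfspace H) \<and> A = closure (interior (\<Inter>\<H>)))"

definition polytopes :: "'a::euclidean_space set set" where
  "polytopes = {A. \<exists>\<B>. finite \<B> \<and> (\<forall>B\<in>\<B>. basic_polytope B) \<and> A = \<Union>\<B>}"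

definition strong_contact :: "'a::topological_space set \<Rightarrow> 'a set \<Rightarrow> bool" where
  "strong_contact A B \<longleftrightarrow>
    (\<exists>E. connected E \<and> open E \<and> E \<subseteq> A \<union> B \<and> E \<inter> A \<noteq> {} \<and> E \<inter> B \<noteq> {})"

definition PSC :: "'a::euclidean_space set contact_structure" where
  "PSC = \<lparr>elems = polytopes, compl_op = (\<lambda>A. closure (- A)), join_op = (\<union>),
          contact_rel = strong_contact\<rparr>"

end

theory Submission
  imports Defs
begin

text \<open>
  The proof builds, for a formula \<open>\<phi>\<close> that is not a theorem, polytopes for which \<open>\<phi>\<close> fails.

  A maximal theory \<open>T\<close> avoiding \<open>\<phi>\<close> decides every formula.  It makes the algebra of terms, up to the
  equalities in \<open>T\<close>, into a contact algebra satisfying the connectedness axiom.  Only the finitely many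
  variables of \<open>\<phi>\<close> matter, so this algebra can be replaced by a finite graph.  Its vertices are the nonzero
  cells (the conjunctions prescribing a sign for each variable), and its edges join the cells in contact.
  Whether an equality or a contact belongs to \<open>T\<close> can be read off from this graph
  (\<open>eqv_iff_eval\<close>, \<open>C_iff_eval\<close>).  The connectedness axiom says precisely that the graph is connected
  (\<open>touch_connected\<close>): otherwise a component and its complement would be nonzero without being in contact.

  A finite connected graph has a walk that runs through all its edges (\<open>covering_walk\<close>).  Such a walk is a
  one-dimensional object, which is why the dimension of the space is irrelevant.  Cut the space by parallel
  hyperplanes into as many slabs as the walk has entries, let the slabs stand for the cells visited by the
  walk in this order, and let each variable denote the union of the slabs whose cell makes it positive.
  Two unions of slabs are in strong contact exactly when they contain slabs that are equal or adjacent
  (\<open>strong_contact_slabs\<close>), that is, when some edge of the graph joins the corresponding sets of cells.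
  Hence a formula in the variables of \<open>\<phi>\<close> holds under this valuation if and only if it belongs to \<open>T\<close>, and
  \<open>\<phi>\<close> itself fails.
\<close>


section \<open>Complete theories\<close>

definition closed_theory :: "fm set \<Rightarrow> bool" where
  "closed_theory T \<longleftrightarrow> {A. F_theorem A} \<subseteq> T \<and> (\<forall>A B. (A \<^bold>\<Rightarrow> B) \<in> T \<longrightarrow> A \<in> T \<longrightarrow> B \<in> T)"

lemma closed_theoryI:
  assumes "\<And>A. F_theorem A \<Longrightarrow> A \<in> T" "\<And>A B. (A \<^bold>\<Rightarrow> B) \<in> T \<Longrightarrow> A \<in> T \<Longrightarrow> B \<in> T"
  shows "closed_theory T"
  using assms unfolding closed_theory_def by blast

lemma theorem_in_theory: "closed_theory T \<Longrightarrow> F_theorem A \<Longrightarrow> A \<in> T"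
  unfolding closed_theory_def by blast

lemma theory_mp: "closed_theory T \<Longrightarrow> (A \<^bold>\<Rightarrow> B) \<in> T \<Longrightarrow> A \<in> T \<Longrightarrow> B \<in> T"
  unfolding closed_theory_def by blast

lemma imp_refl: "F_theorem (A \<^bold>\<Rightarrow> A)"
  by (rule MP[OF MP[OF Prop[OF S[of A "A \<^bold>\<Rightarrow> A" A]] Prop[OF K]] Prop[OF K]])

text \<open>The deduction theorem in semantic form: this is the theory obtained by adding \<open>A\<close> to \<open>T\<close>.\<close>

lemma theory_extend:
  assumes T: "closed_theory T"
  shows "closed_theory {B. (A \<^bold>\<Rightarrow> B) \<in> T}"
proof (rule closed_theoryI)
  fix B assume "F_theorem B"
  then show "B \<in> {B. (A \<^bold>\<Rightarrow> B) \<in> T}"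
    using theory_mp[OF T theorem_in_theory[OF T Prop[OF K]] theorem_in_theory[OF T]] by simp
next
  fix B D assume "(B \<^bold>\<Rightarrow> D) \<in> {B. (A \<^bold>\<Rightarrow> B) \<in> T}" "B \<in> {B. (A \<^bold>\<Rightarrow> B) \<in> T}"
  then show "D \<in> {B. (A \<^bold>\<Rightarrow> B) \<in> T}"
    using theory_mp[OF T theory_mp[OF T theorem_in_theory[OF T Prop[OF S]]]] by simp
qed

text \<open>The condition on negation makes membership in \<open>T\<close> a truth assignment: propositional reasoning
  inside the formal system becomes reasoning about membership.\<close>

definition complete_theory :: "fm set \<Rightarrow> bool" where
  "complete_theory T \<longleftrightarrow> closed_theory T \<and> (\<forall>A. Neg A \<in> T \<longleftrightarrow> A \<notin> T)"

lemma complete_theory_Neg: "complete_theory T \<Longrightarrow> Neg A \<in> T \<longleftrightarrow> A \<notin> T"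
  by (simp add: complete_theory_def)

lemma complete_theory_Or:
  assumes "complete_theory T"
  shows "(A \<^bold>\<or> B) \<in> T \<longleftrightarrow> A \<in> T \<or> B \<in> T"
proof -
  have T: "closed_theory T" and N: "\<And>A. Neg A \<in> T \<longleftrightarrow> A \<notin> T"
    using assms unfolding complete_theory_def by auto
  note ax = theorem_in_theory[OF T Prop]
  have "B \<in> T" if "(A \<^bold>\<or> B) \<in> T" "A \<notin> T"
  proof -
    \<comment> \<open>Implication abbreviates a disjunction, so it follows from the negation of \<open>A\<close>.\<close>
    have "(A \<^bold>\<Rightarrow> B) \<in> T"
      by (rule theory_mp[OF T ax[OF OrI1]]) (simp add: N that(2))
    then have "(A \<^bold>\<or> B \<^bold>\<Rightarrow> B) \<in> T"
      by (rule theory_mp[OF T theory_mp[OF T ax[OF OrE]] theorem_in_theory[OF T imp_refl]])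
    then show ?thesis by (rule theory_mp[OF T]) (rule that(1))
  qed
  then show ?thesis
    using theory_mp[OF T ax[OF OrI1]] theory_mp[OF T ax[OF OrI2]] by blast
qed

text \<open>By Zorn's lemma there is a maximal closed theory avoiding \<open>\<phi>\<close>.  Adding a formula outside it must
  produce \<open>\<phi>\<close>; if this happened for both \<open>A\<close> and its negation, then \<open>\<phi>\<close> would follow by cases.\<close>

lemma complete_theory_avoiding:
  assumes "\<not> F_theorem \<phi>"
  obtains T where "complete_theory T" "\<phi> \<notin> T"
proof -
  let ?S = "{T. closed_theory T \<and> \<phi> \<notin> T}"
  have "\<exists>T\<in>?S. \<forall>U\<in>?S. T \<subseteq> U \<longrightarrow> U = T"
  proof (rule subset_Zorn_nonempty)
    have "closed_theory {A. F_theorem A}" by (auto intro: closed_theoryI MP)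
    then show "?S \<noteq> {}" using assms by blast
  next
    fix \<C> assume ne: "\<C> \<noteq> {}" and ch: "subset.chain ?S \<C>"
    have "closed_theory (\<Union>\<C>)"
    proof (rule closed_theoryI)
      fix A assume "F_theorem A"
      then show "A \<in> \<Union>\<C>"
        using ne ch theorem_in_theory by (fastforce simp: subset_chain_def)
    next
      fix A B assume "(A \<^bold>\<Rightarrow> B) \<in> \<Union>\<C>" "A \<in> \<Union>\<C>"
      then obtain U V where UV: "U \<in> \<C>" "V \<in> \<C>" "(A \<^bold>\<Rightarrow> B) \<in> U" "A \<in> V" by blast
      then have "U \<subseteq> V \<or> V \<subseteq> U" using ch unfolding subset_chain_def by blast
      then obtain W where "W \<in> \<C>" "(A \<^bold>\<Rightarrow> B) \<in> W" "A \<in> W" using UV by blast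
      then have "B \<in> W"
        using ch theory_mp[of W A B] by (auto simp: subset_chain_def)
      then show "B \<in> \<Union>\<C>" using \<open>W \<in> \<C>\<close> by blast
    qed
    then show "\<Union>\<C> \<in> ?S" using ch by (auto simp: subset_chain_def)
  qed
  then obtain T where T: "closed_theory T" "\<phi> \<notin> T"
    and max: "\<And>U. closed_theory U \<Longrightarrow> \<phi> \<notin> U \<Longrightarrow> T \<subseteq> U \<Longrightarrow> U = T" by blast
  note ax = theorem_in_theory[OF T(1) Prop]
  have refuted: "(A \<^bold>\<Rightarrow> \<phi>) \<in> T" if "A \<notin> T" for A
  proof (rule ccontr)
    assume "(A \<^bold>\<Rightarrow> \<phi>) \<notin> T"
    moreover have "T \<subseteq> {B. (A \<^bold>\<Rightarrow> B) \<in> T}"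
      by (auto intro: theory_mp[OF T(1) ax[OF K]])
    ultimately have "{B. (A \<^bold>\<Rightarrow> B) \<in> T} = T"
      using max[OF theory_extend[OF T(1), of A]] by simp
    then show False using that theorem_in_theory[OF T(1) imp_refl, of A] by blast
  qed
  have "Neg A \<in> T \<longleftrightarrow> A \<notin> T" for A
  proof
    assume "Neg A \<in> T"
    then have "(A \<^bold>\<Rightarrow> \<phi>) \<in> T" by (rule theory_mp[OF T(1) ax[OF OrI1]])
    then show "A \<notin> T" using theory_mp[OF T(1), of A \<phi>] T(2) by blast
  next
    assume "A \<notin> T"
    show "Neg A \<in> T"
    proof (rule ccontr)
      assume "Neg A \<notin> T"
      \<comment> \<open>The excluded middle for \<open>A\<close> is literally the formula \<open>A \<^bold>\<Rightarrow> A\<close>.\<close>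
      then have "(Neg A \<^bold>\<or> A \<^bold>\<Rightarrow> \<phi>) \<in> T"
        using theory_mp[OF T(1) theory_mp[OF T(1) ax[OF OrE]]] refuted \<open>A \<notin> T\<close> by simp
      then have "\<phi> \<in> T"
        by (rule theory_mp[OF T(1)]) (rule theorem_in_theory[OF T(1) imp_refl])
      then show False using T(2) by simp
    qed
  qed
  then show thesis using that[of T] T by (simp add: complete_theory_def)
qed


section \<open>The Boolean algebra of terms modulo provable equality\<close>

definition prov_eq :: "trm \<Rightarrow> trm \<Rightarrow> bool" where
  "prov_eq a b \<longleftrightarrow> F_theorem (a \<^bold>= b)"

lemma prov_eq_refl: "prov_eq a a"
  unfolding prov_eq_def by (simp add: Equality Refl)

lemma prov_eq_sym: "prov_eq a b \<Longrightarrow> prov_eq b a"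
  unfolding prov_eq_def by (rule MP[OF Equality[OF Sym]])

lemma prov_eq_trans: "prov_eq a b \<Longrightarrow> prov_eq b c \<Longrightarrow> prov_eq a c"
  unfolding prov_eq_def by (rule MP[OF MP[OF Equality[OF Trans]]])

lemma prov_eq_Compl: "prov_eq a b \<Longrightarrow> prov_eq (Compl a) (Compl b)"
  unfolding prov_eq_def by (rule MP[OF Equality[OF Cong_Compl]])

lemma prov_eq_Join: "prov_eq a b \<Longrightarrow> prov_eq c d \<Longrightarrow> prov_eq (a \<^bold>+ c) (b \<^bold>+ d)"
  unfolding prov_eq_def by (rule MP[OF MP[OF Equality[OF Cong_Join]]])

lemma prov_eq_ba: "ba_axiom (a \<^bold>= b) \<Longrightarrow> prov_eq a b"
  unfolding prov_eq_def by (rule Boolean)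

text \<open>This is the Lindenbaum algebra of terms.  Equality is taken modulo provability, not modulo a complete
  theory, so that the algebra is a type; a theory then enters as a congruence on it.\<close>

quotient_type term_class = trm / prov_eq
  by (intro equivpI reflpI sympI transpI) (blast intro: prov_eq_refl prov_eq_sym prov_eq_trans)+

instantiation term_class :: boolean_algebra
begin

lift_definition uminus_term_class :: "term_class \<Rightarrow> term_class" is Compl
  by (rule prov_eq_Compl)

lift_definition sup_term_class :: "term_class \<Rightarrow> term_class \<Rightarrow> term_class" is Join
  by (rule prov_eq_Join)

lift_definition inf_term_class :: "term_class \<Rightarrow> term_class \<Rightarrow> term_class" is "\<lambda>a b. a \<^bold>\<cdot> b"
  by (intro prov_eq_Compl prov_eq_Join)

lift_definition bot_term_class :: term_class is "Zero (Var 0)" .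

lift_definition top_term_class :: term_class is "One (Var 0)" .

definition minus_term_class :: "term_class \<Rightarrow> term_class \<Rightarrow> term_class" where
  "minus_term_class x y = inf x (- y)"

definition less_eq_term_class :: "term_class \<Rightarrow> term_class \<Rightarrow> bool" where
  "less_eq_term_class x y \<longleftrightarrow> inf x y = x"

definition less_term_class :: "term_class \<Rightarrow> term_class \<Rightarrow> bool" where
  "less_term_class x y \<longleftrightarrow> x \<le> y \<and> \<not> y \<le> x"

instance
proof
  fix x y z :: term_class
  have infA: "inf (inf x y) z = inf x (inf y z)" for x y z :: term_class
    by transfer (rule prov_eq_ba[OF Meet_Assoc])
  have supA: "sup (sup x y) z = sup x (sup y z)" for x y z :: term_class
    by transfer (rule prov_eq_ba[OF Join_Assoc])
  have infC: "inf x y = inf y x" for x y :: term_class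
    by transfer (rule prov_eq_ba[OF Meet_Comm])
  have supC: "sup x y = sup y x" for x y :: term_class
    by transfer (rule prov_eq_ba[OF Join_Comm])
  have abs1: "sup x (inf x y) = x" for x y :: term_class
    by transfer (rule prov_eq_ba[OF Join_Absorb])
  have abs2: "inf x (sup x y) = x" for x y :: term_class
    by transfer (rule prov_eq_ba[OF Meet_Absorb])
  have dist: "sup x (inf y z) = inf (sup x y) (sup x z)" for x y z :: term_class
    by transfer (rule prov_eq_ba[OF Join_Distrib])
  have compl1: "inf x (- x) = bot" for x :: term_class
    by transfer (rule prov_eq_ba[OF Meet_Compl])
  have compl2: "sup x (- x) = top" for x :: term_class
    by transfer (rule prov_eq_ba[OF Join_Compl])
  have infI: "inf x x = x" for x :: term_class
    using abs2[of x "inf x x"] by (simp only: abs1)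
  have le_sup: "x \<le> y \<longleftrightarrow> sup x y = y" for x y :: term_class
    unfolding less_eq_term_class_def
    using abs1[of y x] abs2[of x y] by (auto simp only: infC[of y x] supC[of y x])
  show "x < y \<longleftrightarrow> x \<le> y \<and> \<not> y \<le> x" by (rule less_term_class_def)
  show "x \<le> x" by (simp only: less_eq_term_class_def infI)
  show "x \<le> z" if "x \<le> y" "y \<le> z"
    using that infA[of x y z] by (simp only: less_eq_term_class_def)
  show "x = y" if "x \<le> y" "y \<le> x"
    using that infC[of x y] by (simp only: less_eq_term_class_def)
  show "inf x y \<le> y" for x y :: term_class
    by (simp only: less_eq_term_class_def infA infI)
  then have "inf y x \<le> x" .
  then show "inf x y \<le> x" by (simp only: infC[of x y])
  show "x \<le> inf y z" if "x \<le> y" "x \<le> z"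
    using that infA[of x y z] by (simp only: less_eq_term_class_def)
  show "x \<le> sup x y" for x y :: term_class
    unfolding less_eq_term_class_def by (rule abs2)
  then have "y \<le> sup y x" .
  then show "y \<le> sup x y" by (simp only: supC[of x y])
  show "sup y z \<le> x" if "y \<le> x" "z \<le> x"
    using that supA[of y z x] by (simp only: le_sup)
  show "bot \<le> x" using abs1[of x "- x"] by (simp only: le_sup compl1 supC[of bot x])
  show "x \<le> top" using abs2[of x "- x"] by (simp only: less_eq_term_class_def compl2)
  show "sup x (inf y z) = inf (sup x y) (sup x z)" by (rule dist)
  show "inf x (- x) = bot" by (rule compl1)
  show "sup x (- x) = top" by (rule compl2)
  show "x - y = inf x (- y)" by (rule minus_term_class_def)
qed

end

lemma abs_Zero: "abs_term_class (Zero d) = bot"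
  by transfer (rule prov_eq_ba[OF Meet_Compl])

lemma abs_One: "abs_term_class (One d) = top"
  by transfer (rule prov_eq_Compl[OF prov_eq_ba[OF Meet_Compl]])

primrec bval :: "(nat \<Rightarrow> 'b::boolean_algebra) \<Rightarrow> trm \<Rightarrow> 'b" where
  "bval h (Var x) = h x"
| "bval h (Compl a) = - bval h a"
| "bval h (a \<^bold>+ b) = sup (bval h a) (bval h b)"

lemma bval_abs: "bval (\<lambda>x. abs_term_class (Var x)) a = abs_term_class a"
  by (induction a) (simp_all only: bval.simps uminus_term_class.abs_eq sup_term_class.abs_eq)


section \<open>Contact congruences\<close>

text \<open>The axioms of equality and connected contact, stated for a congruence on a Boolean algebra.  The
  quotient by the congruence is a connected contact algebra, but it need not be formed.\<close>

locale contact_congruence =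
  fixes eqv :: "'b::boolean_algebra \<Rightarrow> 'b \<Rightarrow> bool" (infix "\<doteq>" 50)
    and C :: "'b \<Rightarrow> 'b \<Rightarrow> bool"
  assumes eqv_refl: "x \<doteq> x"
    and eqv_sym: "x \<doteq> y \<Longrightarrow> y \<doteq> x"
    and eqv_trans: "x \<doteq> y \<Longrightarrow> y \<doteq> z \<Longrightarrow> x \<doteq> z"
    and eqv_compl: "x \<doteq> y \<Longrightarrow> - x \<doteq> - y"
    and eqv_sup: "x \<doteq> y \<Longrightarrow> z \<doteq> u \<Longrightarrow> sup x z \<doteq> sup y u"
    and eqv_nontrivial: "\<not> bot \<doteq> top"
    and C_cong: "x \<doteq> y \<Longrightarrow> z \<doteq> u \<Longrightarrow> C x z \<Longrightarrow> C y u"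
    and C_bot: "\<not> C bot x"
    and C_sup: "C x (sup y z) \<longleftrightarrow> C x y \<or> C x z"
    and C_sym: "C x y \<Longrightarrow> C y x"
    and C_refl: "\<not> x \<doteq> bot \<Longrightarrow> C x x"
    and C_connected: "\<not> x \<doteq> bot \<Longrightarrow> \<not> x \<doteq> top \<Longrightarrow> C x (- x)"
begin

lemma eqv_inf: "x \<doteq> y \<Longrightarrow> z \<doteq> u \<Longrightarrow> inf x z \<doteq> inf y u"
  using eqv_compl[OF eqv_sup[OF eqv_compl[of x y] eqv_compl[of z u]]] by simp

definition null :: "'b \<Rightarrow> bool" where "null x \<longleftrightarrow> x \<doteq> bot"

lemma null_bot: "null bot"
  by (simp add: null_def eqv_refl)

lemma null_sup: "null x \<Longrightarrow> null y \<Longrightarrow> null (sup x y)"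
  using eqv_sup[of x bot y bot] by (simp add: null_def)

lemma null_mono: "null y \<Longrightarrow> x \<le> y \<Longrightarrow> null x"
  using eqv_inf[of x x y bot] eqv_refl[of x] by (simp add: null_def inf_absorb1)

lemma not_null_top: "\<not> null top"
  unfolding null_def using eqv_nontrivial eqv_sym[of top bot] by blast

lemma null_compl: "null (- x) \<longleftrightarrow> x \<doteq> top"
  unfolding null_def using eqv_compl[of "- x" bot] eqv_compl[of x top] by (intro iffI) simp_all

text \<open>A Boolean congruence is determined by its ideal of elements equivalent to zero.\<close>

lemma eqv_iff_null: "x \<doteq> y \<longleftrightarrow> null (sup (inf x (- y)) (inf y (- x)))"
proof
  assume "x \<doteq> y"
  then have "null (inf x (- y))" "null (inf y (- x))"
    using eqv_inf[of x y "- y" "- y"] eqv_inf[of y x "- x" "- x"]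
    by (auto simp: null_def eqv_refl eqv_sym)
  then show "null (sup (inf x (- y)) (inf y (- x)))" by (rule null_sup)
next
  assume n: "null (sup (inf x (- y)) (inf y (- x)))"
  have absorb: "u \<doteq> inf u w" if "null (inf u (- w))" for u w
  proof -
    have "sup (inf u w) (inf u (- w)) = u"
      by (simp flip: inf_sup_distrib1)
    then show ?thesis
      using eqv_sup[OF eqv_refl[of "inf u w"], of "inf u (- w)" bot] that
      by (simp add: null_def)
  qed
  have "x \<doteq> inf x y" by (rule absorb) (rule null_mono[OF n sup_ge1])
  moreover have "y \<doteq> inf y x" by (rule absorb) (rule null_mono[OF n sup_ge2])
  then have "inf x y \<doteq> y" by (simp only: inf_commute[of x y] eqv_sym)
  ultimately show "x \<doteq> y" by (rule eqv_trans)
qed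

lemma C_mono:
  assumes "C x y" "x \<le> x'" "y \<le> y'"
  shows "C x' y'"
proof -
  have up: "C u w'" if "C u w" "w \<le> w'" for u w w'
    using C_sup[of u w w'] that by (simp add: sup.absorb2)
  show ?thesis by (rule up[OF C_sym[OF up[OF C_sym[OF assms(1)] assms(2)]] assms(3)])
qed

lemma C_not_null: "C x y \<Longrightarrow> \<not> null x"
  using C_cong[of x bot y y] C_bot eqv_refl[of y] by (auto simp: null_def)

end


section \<open>The congruence of a complete theory\<close>

lemma theory_eq_trans:
  assumes "closed_theory T" "(a \<^bold>= b) \<in> T" "(b \<^bold>= c) \<in> T"
  shows "(a \<^bold>= c) \<in> T"
  using theory_mp[OF assms(1) theory_mp[OF assms(1) theorem_in_theory[OF assms(1) Equality[OF Trans]]]] assms(2,3) by simp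

lemma theory_eq_sym:
  assumes "closed_theory T" "(a \<^bold>= b) \<in> T"
  shows "(b \<^bold>= a) \<in> T"
  using theory_mp[OF assms(1) theorem_in_theory[OF assms(1) Equality[OF Sym]]] assms(2) by simp

lemma theory_Con_cong:
  assumes "closed_theory T" "(a \<^bold>= b) \<in> T" "(c \<^bold>= d) \<in> T" "Con a c \<in> T"
  shows "Con b d \<in> T"
  using theory_mp[OF assms(1) theory_mp[OF assms(1) theory_mp[OF assms(1)
        theorem_in_theory[OF assms(1) Equality[OF Cong_Con]]]]] assms(2,3,4) by simp

lemma abs_eq_theory:
  assumes "closed_theory T" "abs_term_class a = abs_term_class b"
  shows "(a \<^bold>= b) \<in> T"
  using theorem_in_theory[OF assms(1)] assms(2) by (simp add: term_class.abs_eq_iff prov_eq_def)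

text \<open>Both relations quantify over representatives because respecting provable equality depends on \<open>T\<close>
  being closed.\<close>

definition class_eq :: "fm set \<Rightarrow> term_class \<Rightarrow> term_class \<Rightarrow> bool" where
  "class_eq T x y \<longleftrightarrow> (\<exists>a b. x = abs_term_class a \<and> y = abs_term_class b \<and> (a \<^bold>= b) \<in> T)"

definition class_con :: "fm set \<Rightarrow> term_class \<Rightarrow> term_class \<Rightarrow> bool" where
  "class_con T x y \<longleftrightarrow> (\<exists>a b. x = abs_term_class a \<and> y = abs_term_class b \<and> Con a b \<in> T)"

lemma class_eq_abs:
  assumes T: "closed_theory T"
  shows "class_eq T (abs_term_class a) (abs_term_class b) \<longleftrightarrow> (a \<^bold>= b) \<in> T"
proof
  assume "class_eq T (abs_term_class a) (abs_term_class b)"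
  then obtain c d where cd: "abs_term_class a = abs_term_class c"
    "abs_term_class b = abs_term_class d" "(c \<^bold>= d) \<in> T"
    unfolding class_eq_def by blast
  have "(a \<^bold>= d) \<in> T"
    by (rule theory_eq_trans[OF T abs_eq_theory[OF T cd(1)] cd(3)])
  then show "(a \<^bold>= b) \<in> T"
    by (rule theory_eq_trans[OF T _ theory_eq_sym[OF T abs_eq_theory[OF T cd(2)]]])
qed (auto simp: class_eq_def)

lemma class_con_abs:
  assumes T: "closed_theory T"
  shows "class_con T (abs_term_class a) (abs_term_class b) \<longleftrightarrow> Con a b \<in> T"
proof
  assume "class_con T (abs_term_class a) (abs_term_class b)"
  then obtain c d where cd: "abs_term_class a = abs_term_class c"
    "abs_term_class b = abs_term_class d" "Con c d \<in> T"
    unfolding class_con_def by blast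
  show "Con a b \<in> T"
    by (rule theory_Con_cong[OF T theory_eq_sym[OF T abs_eq_theory[OF T cd(1)]]
          theory_eq_sym[OF T abs_eq_theory[OF T cd(2)]] cd(3)])
qed (auto simp: class_con_def)

lemma class_exhaust:
  obtains a where "x = abs_term_class a"
  by (induct x rule: term_class.abs_induct) simp

lemma contact_congruence_theory:
  assumes ct: "complete_theory T"
  shows "contact_congruence (class_eq T) (class_con T)"
proof
  have T: "closed_theory T" using ct by (simp add: complete_theory_def)
  note ceq = class_eq_abs[OF T] and ccon = class_con_abs[OF T]
  note bots = abs_Zero[of "Var 0", symmetric] and tops = abs_One[of "Var 0", symmetric]
  note ops = uminus_term_class.abs_eq sup_term_class.abs_eq
  note conn = complete_theory_Neg[OF ct] complete_theory_Or[OF ct]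
  note eqax = theorem_in_theory[OF T Equality] and conax = theorem_in_theory[OF T Contact]
  fix x y z u :: term_class
  obtain a b c d where abcd: "x = abs_term_class a" "y = abs_term_class b"
    "z = abs_term_class c" "u = abs_term_class d"
    using class_exhaust by metis
  show "class_eq T x x"
    using eqax[OF Refl[of a]] by (simp add: abcd ceq)
  show "class_eq T y x" if "class_eq T x y"
    using that eqax[OF Sym[of a b]] by (simp add: abcd ceq conn)
  show "class_eq T x z" if "class_eq T x y" "class_eq T y z"
    using that eqax[OF Trans[of a b c]] by (simp add: abcd ceq conn)
  show "class_eq T (- x) (- y)" if "class_eq T x y"
    using that eqax[OF Cong_Compl[of a b]] by (simp add: abcd ceq ops conn)
  show "class_eq T (sup x z) (sup y u)" if "class_eq T x y" "class_eq T z u"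
    using that eqax[OF Cong_Join[of a b c d]] by (simp add: abcd ceq ops conn)
  show "\<not> class_eq T bot top"
    using theorem_in_theory[OF T Boolean[OF Zero_One[of "Var 0"]]]
    by (simp only: bots tops ceq conn not_not simp_thms)
  show "class_con T y u" if "class_eq T x y" "class_eq T z u" "class_con T x z"
    using that eqax[OF Cong_Con[of a b c d]] by (simp add: abcd ceq ccon conn)
  show "\<not> class_con T bot x"
    using conax[OF Con_Zero[of "Var 0" a]] by (simp only: bots abcd ccon conn not_False_eq_True)
  show "class_con T x (sup y z) \<longleftrightarrow> class_con T x y \<or> class_con T x z"
    using conax[OF Con_Join[of a b c]] by (auto simp: abcd ccon ops conn)
  show "class_con T y x" if "class_con T x y"
    using that conax[OF Con_Sym[of a b]] by (simp add: abcd ccon conn)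
  show "class_con T x x" if "\<not> class_eq T x bot"
    using that conax[OF Con_Refl[of a "Var 0"]]
    by (simp only: bots abcd ceq ccon conn not_not simp_thms)
  show "class_con T x (- x)" if "\<not> class_eq T x bot" "\<not> class_eq T x top"
    using that conax[OF Con_Connected[of a "Var 0"]]
    by (simp only: bots tops ops abcd ceq ccon conn not_not simp_thms)
qed


section \<open>Cells of finitely many variables\<close>

text \<open>The sign pattern \<open>p\<close> lists the variables that occur positively.  For \<open>p \<subseteq> set xs\<close>, the nonzero cells
  are the atoms of the subalgebra generated by the values of the variables in \<open>xs\<close>.\<close>

primrec cell :: "(nat \<Rightarrow> 'b::boolean_algebra) \<Rightarrow> nat list \<Rightarrow> nat set \<Rightarrow> 'b" where
  "cell h [] p = top"
| "cell h (x # xs) p = inf (if x \<in> p then h x else - h x) (cell h xs p)"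

text \<open>Two-valued evaluation: a pattern is a valuation in the two-element Boolean algebra.\<close>

abbreviation eval :: "nat set \<Rightarrow> trm \<Rightarrow> bool" where
  "eval p \<equiv> bval (\<lambda>x. x \<in> p)"

primrec trm_vars :: "trm \<Rightarrow> nat list" where
  "trm_vars (Var x) = [x]"
| "trm_vars (Compl a) = trm_vars a"
| "trm_vars (a \<^bold>+ b) = trm_vars a @ trm_vars b"

lemma cell_var:
  "x \<in> set xs \<Longrightarrow> cell h xs p \<le> (if x \<in> p then h x else - h x)"
  by (induction xs) (auto simp: le_infI1 le_infI2)

lemma cell_decides:
  "set (trm_vars a) \<subseteq> set xs \<Longrightarrow> cell h xs p \<le> (if eval p a then bval h a else - bval h a)"
proof (induction a)
  case (Var x)
  then show ?case using cell_var[of x xs h p] by auto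
next
  case (Join a b)
  then show ?case by (cases "eval p a"; cases "eval p b") (simp_all add: le_supI1 le_supI2)
next
  case (Compl a)
  then show ?case by (cases "eval p a") simp_all
qed

lemma cell_cong: "\<forall>x\<in>set xs. x \<in> p \<longleftrightarrow> x \<in> q \<Longrightarrow> cell h xs p = cell h xs q"
  by (induction xs) simp_all

text \<open>A property that passes from a join to one of the two joined elements passes from \<open>y\<close> to its part in some
  cell, since \<open>y\<close> is the join of its parts inside and outside the value of each variable in turn.  Both
  being nonzero and being in contact with a fixed element are such properties.\<close>

lemma cell_split:
  assumes "distinct xs" "P y" and "\<And>u w. P (sup u w) \<Longrightarrow> P u \<or> P w"
  shows "\<exists>p\<subseteq>set xs. P (inf (cell h xs p) y)"
  using assms(1,2)
proof (induction xs arbitrary: y)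
    case Nil
    then show ?case by simp
  next
    case (Cons x xs)
    have "P (sup (inf (h x) y) (inf (- h x) y))"
      using Cons.prems by (simp flip: inf_sup_distrib2)
    then have "\<exists>b. P (inf (if b then h x else - h x) y)"
      using assms(3) by (simp add: ex_bool_eq)
    then obtain b where b: "P (inf (if b then h x else - h x) y)" ..
    obtain p where p: "p \<subseteq> set xs" "P (inf (cell h xs p) (inf (if b then h x else - h x) y))"
      using Cons.IH[OF _ b] Cons.prems(1) by auto
    \<comment> \<open>As \<open>x\<close> does not occur in \<open>xs\<close>, its sign can be fixed without disturbing the cell over \<open>xs\<close>.\<close>
    define q where "q = (if b then insert x p else p)"
    have x: "x \<notin> p" using p(1) Cons.prems(1) by auto
    have "cell h xs q = cell h xs p"
      using Cons.prems(1) by (intro cell_cong) (auto simp: q_def)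
    then have "inf (cell h (x # xs) q) y = inf (cell h xs p) (inf (if b then h x else - h x) y)"
      using x by (simp add: q_def ac_simps)
    then show ?case using p by (intro exI[of _ q]) (auto simp: q_def)
qed

lemma cells_disjoint:
  assumes "p \<subseteq> set xs" "q \<subseteq> set xs" "p \<noteq> q"
  shows "cell h xs p \<le> - cell h xs q"
proof -
  obtain x where x: "x \<in> set xs" "(x \<in> p) \<noteq> (x \<in> q)" using assms by blast
  have "cell h xs p \<le> - (if x \<in> q then h x else - h x)"
    using cell_var[OF x(1), of h p] x(2) by (auto split: if_splits)
  also have "\<dots> \<le> - cell h xs q"
    using cell_var[OF x(1), of h q] by (simp only: compl_mono)
  finally show ?thesis .
qed

text \<open>The join of the cells in \<open>S\<close> is such a \<open>y\<close>.  The axiom of connected contact speaks of elements of the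
  algebra, and this element represents a set of vertices of the graph of cells.\<close>

lemma separate_cells:
  assumes "finite S" "S \<subseteq> Pow (set xs)"
  shows "\<exists>y. (\<forall>p\<in>S. cell h xs p \<le> y) \<and> (\<forall>p\<subseteq>set xs. p \<notin> S \<longrightarrow> cell h xs p \<le> - y)"
  using assms
proof (induction S)
    case empty
    show ?case by (intro exI[of _ bot]) simp
  next
    case (insert q S)
    then obtain y where y: "\<forall>p\<in>S. cell h xs p \<le> y"
      "\<forall>p\<subseteq>set xs. p \<notin> S \<longrightarrow> cell h xs p \<le> - y" by auto
    then show ?case
      using cells_disjoint[of _ xs q h] insert.prems
      by (intro exI[of _ "sup y (cell h xs q)"]) (auto simp: le_supI1)
qed


section \<open>Covering walks in connected graphs\<close>

definition steps :: "'a list \<Rightarrow> 'a \<Rightarrow> 'a \<Rightarrow> bool" where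
  "steps w p q \<longleftrightarrow> (\<exists>i. Suc i < length w \<and> w ! i = p \<and> w ! Suc i = q)"

lemma steps_append: "steps w p q \<Longrightarrow> steps (w @ u) p q"
  unfolding steps_def by (force simp: nth_append)

lemma path_list:
  assumes "R\<^sup>*\<^sup>* x y"
  shows "\<exists>ys. successively R (x # ys) \<and> last (x # ys) = y"
  using assms
proof (induction rule: rtranclp_induct)
  case base
  show ?case by (intro exI[of _ "[]"]) simp
next
  case (step y z)
  then obtain ys where "successively R (x # ys)" "last (x # ys) = y" by blast
  then have "successively R (x # (ys @ [z]))"
    using step(2) successively_append_iff[of R "x # ys" "[z]"] by simp
  then show ?case by (intro exI[of _ "ys @ [z]"]) simp
qed

text \<open>Edges are added one at a time: the walk so far is continued along a path to the source of the new edge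
  and then across it.  The walk starts by repeating a vertex, which makes its length at least two.\<close>

lemma covering_walk:
  assumes "finite {(p, q). R p q}" and "R p0 p0"
    and conn: "\<And>p q. R p p \<Longrightarrow> R q q \<Longrightarrow> R\<^sup>*\<^sup>* p q"
    and ends: "\<And>p q. R p q \<Longrightarrow> R p p \<and> R q q"
  obtains w where "2 \<le> length w" "successively R w" "\<And>p q. R p q \<Longrightarrow> steps w p q"
proof -
  have "\<exists>w. 2 \<le> length w \<and> successively R w \<and> R (last w) (last w) \<and> (\<forall>(p, q)\<in>E. steps w p q)"
    if "finite E" "E \<subseteq> {(p, q). R p q}" for E
    using that
  proof (induction E)
    case empty
    show ?case using assms(2) by (intro exI[of _ "[p0, p0]"]) simp
  next
    case (insert e E)
    then obtain w where w: "2 \<le> length w" "successively R w" "R (last w) (last w)"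
      "\<forall>(p, q)\<in>E. steps w p q" by auto
    obtain p q where e: "e = (p, q)" "R p q" using insert.prems by auto
    obtain ys where ys: "successively R (last w # ys)" "last (last w # ys) = p"
      using path_list[OF conn] w(3) ends[OF e(2)] by metis
    define u where "u = w @ ys"
    have ne: "w \<noteq> []" using w(1) by auto
    have "last u = p" using ys(2) ne by (auto simp: u_def)
    have "successively R u"
      using w(2) ys(1) unfolding u_def
      by (cases ys) (auto simp: successively_append_iff)
    have "successively R (u @ [q])"
      using \<open>successively R u\<close> \<open>last u = p\<close> e(2) by (simp add: successively_append_iff)
    moreover have "steps (u @ [q]) p q"
    proof -
      have "u \<noteq> []" using ne by (simp add: u_def)
      then have "Suc (length u - 1) = length u" "u ! (length u - 1) = p"
        using \<open>last u = p\<close> by (simp_all add: last_conv_nth)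
      then show ?thesis
        unfolding steps_def by (intro exI[of _ "length u - 1"]) (simp add: nth_append)
    qed
    moreover have "steps (u @ [q]) r s" if "(r, s) \<in> E" for r s
      using w(4) that by (auto simp: u_def intro!: steps_append)
    ultimately show ?case
      using e ends[OF e(2)] w(1) by (intro exI[of _ "u @ [q]"]) (auto simp: u_def)
  qed
  from this[OF assms(1) subset_refl] show thesis using that by blast
qed

lemma steps_in_set: "steps w p q \<Longrightarrow> p \<in> set w"
  by (auto simp: steps_def)

text \<open>In a walk with at least two entries, every entry is an end of some edge.\<close>

lemma walk_loops:
  assumes "2 \<le> length w" "successively R w" and "\<And>p q. R p q \<Longrightarrow> R p p \<and> R q q"
    and "p \<in> set w"
  shows "R p p"
proof -
  obtain i where i: "i < length w" "w ! i = p" using assms(4) by (auto simp: in_set_conv_nth)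
  show ?thesis
  proof (cases i)
    case 0
    then show ?thesis using assms(3) successively_nth[OF assms(2), of 0] assms(1) i by auto
  next
    case (Suc k)
    then show ?thesis using assms(3) successively_nth[OF assms(2), of k] i by auto
  qed
qed


section \<open>The graph of cells in contact\<close>

context contact_congruence
begin

context
  fixes h :: "nat \<Rightarrow> 'b" and xs :: "nat list"
  assumes distinct: "distinct xs"
begin

text \<open>Patterns of null cells touch nothing, so the vertices of this graph are the patterns that touch
  themselves.\<close>

definition touch :: "nat set \<Rightarrow> nat set \<Rightarrow> bool" where
  "touch p q \<longleftrightarrow> p \<subseteq> set xs \<and> q \<subseteq> set xs \<and> C (cell h xs p) (cell h xs q)"

lemma touch_self: "touch p p \<longleftrightarrow> p \<subseteq> set xs \<and> \<not> null (cell h xs p)"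
  using C_refl C_not_null by (auto simp: touch_def null_def)

lemma not_null_split:
  assumes "\<not> null y"
  shows "\<exists>p. touch p p \<and> \<not> null (inf (cell h xs p) y)"
proof -
  obtain p where "p \<subseteq> set xs" "\<not> null (inf (cell h xs p) y)"
    using cell_split[of xs "\<lambda>u. \<not> null u" y h] distinct assms null_sup by blast
  then show ?thesis using touch_self null_mono inf_le1 by metis
qed

lemma C_split:
  assumes "C y z"
  shows "\<exists>p q. touch p q \<and> C (inf (cell h xs p) y) (inf (cell h xs q) z)"
proof -
  obtain p where p: "p \<subseteq> set xs" "C (inf (cell h xs p) y) z"
    using cell_split[of xs "\<lambda>u. C u z" y h] distinct assms C_sup C_sym by blast
  obtain q where q: "q \<subseteq> set xs" "C (inf (cell h xs p) y) (inf (cell h xs q) z)"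
    using cell_split[of xs "C (inf (cell h xs p) y)" z h] distinct p C_sup by blast
  then show ?thesis using p(1) C_mono[OF q(2) inf_le1 inf_le1] unfolding touch_def by blast
qed

lemma touch_ends: "touch p q \<Longrightarrow> touch p p \<and> touch q q"
  using touch_self C_not_null C_sym by (meson touch_def)

text \<open>Let \<open>y\<close> be the join of the cells reachable from \<open>p\<close>.  If \<open>q\<close> is not reachable, then neither \<open>y\<close> nor \<open>- y\<close>
  is null, so the two are in contact; splitting both sides into cells gives an edge that leaves the
  reachable part.\<close>

lemma touch_connected:
  assumes "touch p p" "touch q q"
  shows "touch\<^sup>*\<^sup>* p q"
proof (rule ccontr)
  assume nq: "\<not> touch\<^sup>*\<^sup>* p q"
  define S where "S = {r. r \<subseteq> set xs \<and> touch\<^sup>*\<^sup>* p r}"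
  have "finite S" by (rule finite_subset[of _ "Pow (set xs)"]) (auto simp: S_def)
  then obtain y where y: "\<And>r. r \<in> S \<Longrightarrow> cell h xs r \<le> y"
    "\<And>r. r \<subseteq> set xs \<Longrightarrow> r \<notin> S \<Longrightarrow> cell h xs r \<le> - y"
    using separate_cells[of S xs h] by (force simp: S_def)
  have "cell h xs p \<le> y" "cell h xs q \<le> - y"
    using assms nq y by (auto simp: S_def touch_self)
  then have "\<not> null y" "\<not> null (- y)"
    using assms touch_self null_mono[of y "cell h xs p"] null_mono[of "- y" "cell h xs q"] by auto
  then have "C y (- y)" using C_connected[of y] null_compl[of y] null_def[of y] by simp
  then obtain r s where rs: "touch r s" "C (inf (cell h xs r) y) (inf (cell h xs s) (- y))"
    using C_split by blast
  have "r \<in> S"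
  proof (rule ccontr)
    assume "r \<notin> S"
    then have "inf (cell h xs r) y = bot" using y(2) rs(1) by (simp add: touch_def inf_shunt)
    then show False using rs(2) C_bot by simp
  qed
  moreover have "s \<notin> S"
  proof
    assume "s \<in> S"
    then have "inf (cell h xs s) (- y) = bot" using y(1) by (simp add: inf_shunt)
    then show False using rs(2) C_bot C_sym by metis
  qed
  moreover have "s \<in> S" if "r \<in> S"
    using that rs(1) rtranclp.rtrancl_into_rtrancl[of touch p r s] by (simp add: S_def touch_def)
  ultimately show False by blast
qed

text \<open>Together with the corresponding lemma for contact, this says that the graph of patterns alone determines
  which atomic formulas in the variables \<open>xs\<close> are true.\<close>

lemma eqv_iff_eval:
  assumes "set (trm_vars a) \<subseteq> set xs" "set (trm_vars b) \<subseteq> set xs"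
  shows "bval h a \<doteq> bval h b \<longleftrightarrow> (\<forall>p. touch p p \<longrightarrow> eval p a = eval p b)"
    (is "?l \<longleftrightarrow> ?r")
proof -
  define d where "d = sup (inf (bval h a) (- bval h b)) (inf (bval h b) (- bval h a))"
  have dec: "cell h xs p \<le> (if eval p a = eval p b then - d else d)" for p
    using cell_decides[OF assms(1), of h p] cell_decides[OF assms(2), of h p] unfolding d_def
    by (cases "eval p a"; cases "eval p b") (simp_all add: le_supI1 le_supI2)
  have "?l \<longleftrightarrow> null d" unfolding d_def by (rule eqv_iff_null)
  also have "\<dots> \<longleftrightarrow> ?r"
  proof
    assume n: "null d"
    show ?r
    proof (intro allI impI, rule ccontr)
      fix p assume p: "touch p p" and "eval p a \<noteq> eval p b"
      then have "cell h xs p \<le> d" using dec[of p] by simp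
      then have "null (cell h xs p)" by (rule null_mono[OF n])
      then show False using p touch_self by blast
    qed
  next
    assume r: ?r
    show "null d"
    proof (rule ccontr)
      assume "\<not> null d"
      then obtain p where p: "touch p p" "\<not> null (inf (cell h xs p) d)"
        using not_null_split by blast
      then have "cell h xs p \<le> - d" using r dec[of p] by simp
      then have "inf (cell h xs p) d = bot" by (simp add: inf_shunt)
      then show False using p(2) null_bot by simp
    qed
  qed
  finally show ?thesis .
qed

lemma C_iff_eval:
  assumes "set (trm_vars a) \<subseteq> set xs" "set (trm_vars b) \<subseteq> set xs"
  shows "C (bval h a) (bval h b) \<longleftrightarrow> (\<exists>p q. touch p q \<and> eval p a \<and> eval q b)"
proof
  assume "C (bval h a) (bval h b)"
  then obtain p q where
    pq: "touch p q" "C (inf (cell h xs p) (bval h a)) (inf (cell h xs q) (bval h b))"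
    using C_split by blast
  have "eval p a" 
  proof (rule ccontr)
    assume "\<not> eval p a"
    then have "inf (cell h xs p) (bval h a) = bot"
      using cell_decides[OF assms(1), of h p] by (simp add: inf_shunt)
    then show False using pq(2) C_bot by metis
  qed
  moreover have "eval q b" 
  proof (rule ccontr)
    assume "\<not> eval q b"
    then have "inf (cell h xs q) (bval h b) = bot"
      using cell_decides[OF assms(2), of h q] by (simp add: inf_shunt)
    then show False using pq(2) C_bot C_sym[of _ bot] by metis
  qed
  ultimately show "\<exists>p q. touch p q \<and> eval p a \<and> eval q b" using pq(1) by blast
next
  assume "\<exists>p q. touch p q \<and> eval p a \<and> eval q b"
  then obtain p q where pq: "touch p q" "eval p a" "eval q b" by blast
  then have "cell h xs p \<le> bval h a" "cell h xs q \<le> bval h b"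
    using cell_decides[OF assms(1), of h p] cell_decides[OF assms(2), of h q] by simp_all
  then show "C (bval h a) (bval h b)" using C_mono pq(1) touch_def by blast
qed

lemma touch_walk:
  obtains w where "2 \<le> length w" "successively touch w" "\<And>p q. touch p q \<Longrightarrow> steps w p q"
proof -
  have "finite {(p, q). touch p q}"
    by (rule finite_subset[of _ "Pow (set xs) \<times> Pow (set xs)"]) (auto simp: touch_def)
  moreover obtain p where "touch p p" using not_null_split[of top] not_null_top by blast
  ultimately show thesis
    by (rule covering_walk) (use touch_connected touch_ends that in \<open>blast+\<close>)
qed

end

end


section \<open>Polytopes cut out by parallel hyperplanes\<close>

text \<open>For \<open>m \<ge> 2\<close> and a unit vector \<open>u\<close>, the slabs with indices below \<open>m\<close> cut the space along parallel
  hyperplanes; the first and the last of them are half-spaces.\<close>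

definition slab :: "'a::euclidean_space \<Rightarrow> nat \<Rightarrow> nat \<Rightarrow> 'a set" where
  "slab u m i = {x. (i \<noteq> 0 \<longrightarrow> real i \<le> u \<bullet> x) \<and> (Suc i \<noteq> m \<longrightarrow> u \<bullet> x \<le> real (Suc i))}"

text \<open>For \<open>i = j\<close> this is the interior of a slab; for \<open>j = i + 1\<close> it is the interior of the union of two
  adjacent slabs, including the hyperplane between them.\<close>

definition open_slab :: "'a::euclidean_space \<Rightarrow> nat \<Rightarrow> nat \<Rightarrow> nat \<Rightarrow> 'a set" where
  "open_slab u m i j =
    {x. (i \<noteq> 0 \<longrightarrow> real i < u \<bullet> x) \<and> (Suc j \<noteq> m \<longrightarrow> u \<bullet> x < real (Suc j))}"

definition slabs :: "'a::euclidean_space \<Rightarrow> nat \<Rightarrow> nat set \<Rightarrow> 'a set" where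
  "slabs u m I = (\<Union>i\<in>I. slab u m i)"

lemma strong_contact_sym: "strong_contact A B \<Longrightarrow> strong_contact B A"
  unfolding strong_contact_def by (metis Un_commute)

context
  fixes u :: "'a::euclidean_space" and m :: nat
  assumes u: "u \<bullet> u = 1" and m: "2 \<le> m"
begin

lemma u_nonzero: "u \<noteq> 0" using u by auto

text \<open>With at least two slabs this set of half-spaces is never empty, as the definition of a basic polytope
  demands.\<close>

definition slab_bounds :: "nat \<Rightarrow> 'a set set" where
  "slab_bounds i = (if i = 0 then {} else {{x. (- u) \<bullet> x \<le> - real i}})
     \<union> (if Suc i = m then {} else {{x. u \<bullet> x \<le> real (Suc i)}})"

lemma slab_eq: "slab u m i = \<Inter> (slab_bounds i)"
  by (auto simp: slab_def slab_bounds_def)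

lemma interior_slab: "interior (slab u m i) = open_slab u m i i"
  unfolding slab_eq slab_bounds_def open_slab_def using u_nonzero
  by (auto simp: interior_halfspace_le interior_halfspace_ge)

lemma convex_slab: "convex (slab u m i)"
  unfolding slab_eq slab_bounds_def
  by (auto intro!: convex_Int convex_halfspace_ge convex_halfspace_le split: if_splits)

lemma midpoint_in_open_slab: "((real i + 1/2) *\<^sub>R u) \<in> open_slab u m i i"
  using u by (simp add: open_slab_def)

lemma midpoint_in_slab_iff:
  "i < m \<Longrightarrow> j < m \<Longrightarrow> ((real i + 1/2) *\<^sub>R u) \<in> slab u m j \<longleftrightarrow> i = j"
  using u by (auto simp: slab_def)

lemma closed_slab: "closed (slab u m i)"
  unfolding slab_eq slab_bounds_def
  by (auto intro!: closed_Int closed_halfspace_ge closed_halfspace_le split: if_splits)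

lemma closure_interior_slab: "closure (interior (slab u m i)) = slab u m i"
proof -
  have "interior (slab u m i) \<noteq> {}"
    using midpoint_in_open_slab by (auto simp: interior_slab)
  then show ?thesis
    using convex_closure_interior[OF convex_slab] closure_closed[OF closed_slab] by metis
qed

lemma basic_polytope_slab: "basic_polytope (slab u m i)"
  unfolding basic_polytope_def
proof (intro exI conjI)
  show "finite (slab_bounds i)" by (simp add: slab_bounds_def)
  show "slab_bounds i \<noteq> {}" using m by (auto simp: slab_bounds_def)
  have half: "closed_halfspace {x. a \<bullet> x \<le> b}" if "a \<noteq> 0" for a :: 'a and b
    using that unfolding closed_halfspace_def by blast
  show "\<forall>H\<in>slab_bounds i. closed_halfspace H"
    using half[of "- u" "- real i"] half[of u "real (Suc i)"] u_nonzero
    by (simp add: slab_bounds_def)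
  show "slab u m i = closure (interior (\<Inter> (slab_bounds i)))"
    using closure_interior_slab[of i] by (simp only: slab_eq)
qed

lemma slabs_polytope: "I \<subseteq> {..<m} \<Longrightarrow> slabs u m I \<in> polytopes"
  unfolding polytopes_def slabs_def
  using basic_polytope_slab finite_subset[of I "{..<m}"]
  by (auto intro!: exI[of _ "slab u m ` I"])

lemma slab_cover: "\<exists>i<m. x \<in> slab u m i"
proof -
  \<comment> \<open>Conversion to \<open>nat\<close> sends negative values to the first slab; the minimum sends large ones to the last.\<close>
  define i where "i = min (nat \<lfloor>u \<bullet> x\<rfloor>) (m - 1)"
  have "i < m" using m by (simp add: i_def)
  moreover have "x \<in> slab u m i"
    unfolding slab_def i_def using m by (auto simp: min_def) linarith+
  ultimately show ?thesis by blast
qed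

lemma open_slab_disjoint_slab:
  assumes "i < m" "j < m" "i \<noteq> j"
  shows "open_slab u m i i \<inter> slab u m j = {}"
proof -
  have "i < j \<or> j < i" using assms by auto
  then show ?thesis using assms by (auto simp: open_slab_def slab_def)
qed

lemma meeting_slabs:
  assumes "i < m" "j < m" "x \<in> slab u m i" "x \<in> slab u m j"
  shows "i \<le> Suc j"
proof (rule ccontr)
  assume "\<not> i \<le> Suc j"
  then show False using assms by (auto simp: slab_def)
qed

lemma slabs_Un: "slabs u m I \<union> slabs u m J = slabs u m (I \<union> J)"
  by (auto simp: slabs_def)

lemma closed_slabs: "I \<subseteq> {..<m} \<Longrightarrow> closed (slabs u m I)"
  unfolding slabs_def using finite_subset[of I "{..<m}"] by (auto intro: closed_slab)

text \<open>The complement of a union of slabs lacks the boundary hyperplanes; the closure restores them, since each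
  slab is the closure of its interior.\<close>

lemma slabs_compl:
  assumes "I \<subseteq> {..<m}"
  shows "closure (- slabs u m I) = slabs u m ({..<m} - I)"
proof
  have "- slabs u m I \<subseteq> slabs u m ({..<m} - I)"
    using slab_cover by (force simp: slabs_def)
  then show "closure (- slabs u m I) \<subseteq> slabs u m ({..<m} - I)"
    by (intro closure_minimal closed_slabs) auto
  have "slab u m j \<subseteq> closure (- slabs u m I)" if "j < m" "j \<notin> I" for j
  proof -
    have "interior (slab u m j) \<subseteq> - slabs u m I"
      using open_slab_disjoint_slab[of j] that assms by (fastforce simp: interior_slab slabs_def)
    then show ?thesis using closure_interior_slab closure_mono by metis
  qed
  then show "slabs u m ({..<m} - I) \<subseteq> closure (- slabs u m I)"
    by (auto simp: slabs_def)
qed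

lemma slabs_inj:
  assumes "I \<subseteq> {..<m}" "J \<subseteq> {..<m}"
  shows "slabs u m I = slabs u m J \<longleftrightarrow> I = J"
proof -
  \<comment> \<open>The index set is recovered by testing one interior point of each slab.\<close>
  have "i \<in> I \<longleftrightarrow> i < m \<and> ((real i + 1/2) *\<^sub>R u) \<in> slabs u m I" if "I \<subseteq> {..<m}" for i I
    using that midpoint_in_slab_iff[of i] by (auto simp: slabs_def)
  from this[OF assms(1)] this[OF assms(2)] show ?thesis by (metis subsetI subset_antisym)
qed

lemma strong_contact_adjacent:
  assumes I: "I \<subseteq> {..<m}" and J: "J \<subseteq> {..<m}" and "i \<in> I" "j \<in> J" "i \<le> j" "j \<le> Suc i"
  shows "strong_contact (slabs u m I) (slabs u m J)"
  unfolding strong_contact_def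
proof (intro exI conjI)
  have "open_slab u m i j = (if i = 0 then UNIV else {x. u \<bullet> x > real i})
      \<inter> (if Suc j = m then UNIV else {x. u \<bullet> x < real (Suc j)})"
    by (auto simp: open_slab_def)
  then show "connected (open_slab u m i j)" "open (open_slab u m i j)"
    by (auto intro!: convex_connected convex_Int open_Int convex_halfspace_lt convex_halfspace_gt
        open_halfspace_lt open_halfspace_gt)
  have "open_slab u m i j \<subseteq> slab u m i \<union> slab u m j"
    using assms by (cases "j = i") (auto simp: open_slab_def slab_def le_Suc_eq)
  then show "open_slab u m i j \<subseteq> slabs u m I \<union> slabs u m J"
    using assms by (auto simp: slabs_def)
  have "((real i + 1/2) *\<^sub>R u) \<in> open_slab u m i j" "((real j + 1/2) *\<^sub>R u) \<in> open_slab u m i j"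
    using u assms by (auto simp: open_slab_def)
  moreover have "((real i + 1/2) *\<^sub>R u) \<in> slabs u m I" "((real j + 1/2) *\<^sub>R u) \<in> slabs u m J"
    using assms midpoint_in_open_slab interior_subset[of "slab u m _"]
    by (fastforce simp: slabs_def interior_slab)+
  ultimately show "open_slab u m i j \<inter> slabs u m I \<noteq> {}" "open_slab u m i j \<inter> slabs u m J \<noteq> {}"
    by blast+
qed

text \<open>A connected set covered by two closed sets and meeting both contains a common point of them, and two
  slabs with a common point are equal or adjacent.  Conversely, an open slab spanning two adjacent indices
  witnesses the contact.\<close>

lemma strong_contact_slabs:
  assumes I: "I \<subseteq> {..<m}" and J: "J \<subseteq> {..<m}"
  shows "strong_contact (slabs u m I) (slabs u m J)
    \<longleftrightarrow> (\<exists>i\<in>I. \<exists>j\<in>J. i \<le> Suc j \<and> j \<le> Suc i)"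
proof
  assume "strong_contact (slabs u m I) (slabs u m J)"
  then obtain E where E: "connected E" "E \<subseteq> slabs u m I \<union> slabs u m J"
    "slabs u m I \<inter> E \<noteq> {}" "slabs u m J \<inter> E \<noteq> {}"
    unfolding strong_contact_def by (auto simp: Int_commute)
  then have "slabs u m I \<inter> slabs u m J \<noteq> {}"
    using connected_closedD[OF E(1) _ E(2) closed_slabs[OF I] closed_slabs[OF J]] by auto
  then obtain x i j where x: "i \<in> I" "j \<in> J" "x \<in> slab u m i" "x \<in> slab u m j"
    by (auto simp: slabs_def)
  then have "i < m" "j < m" using I J by auto
  then show "\<exists>i\<in>I. \<exists>j\<in>J. i \<le> Suc j \<and> j \<le> Suc i"
    using x meeting_slabs by blast
next
  assume "\<exists>i\<in>I. \<exists>j\<in>J. i \<le> Suc j \<and> j \<le> Suc i"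
  then obtain i j where ij: "i \<in> I" "j \<in> J" "i \<le> Suc j" "j \<le> Suc i" by blast
  show "strong_contact (slabs u m I) (slabs u m J)"
    using strong_contact_adjacent[OF I J ij(1,2)] strong_contact_adjacent[OF J I ij(2,1)]
      ij(3,4) strong_contact_sym by (cases "i \<le> j") auto
qed

end


section \<open>Completeness\<close>

text \<open>Slab \<open>i\<close> is a realization of the cell with pattern \<open>w ! i\<close>.\<close>

definition slab_valuation :: "'a::euclidean_space \<Rightarrow> nat set list \<Rightarrow> nat \<Rightarrow> 'a set" where
  "slab_valuation u w x = slabs u (length w) {i. i < length w \<and> x \<in> w ! i}"

text \<open>Evaluation of terms happens slab by slab, because complement and join of unions of slabs act on the
  index sets.\<close>

lemma trm_val_slab_valuation:
  assumes u: "u \<bullet> u = 1" and w: "2 \<le> length w"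
  shows "trm_val PSC (slab_valuation u w) a = slabs u (length w) {i. i < length w \<and> eval (w ! i) a}"
proof (induction a)
  case (Var x)
  show ?case by (simp add: slab_valuation_def)
next
  case (Compl a)
  have "{..<length w} - {i. i < length w \<and> eval (w ! i) a} = {i. i < length w \<and> \<not> eval (w ! i) a}"
    by auto
  then show ?case
    using slabs_compl[OF u w, of "{i. i < length w \<and> eval (w ! i) a}"] Compl
    by (auto simp: PSC_def)
next
  case (Join a b)
  have "{i. i < length w \<and> (eval (w ! i) a \<or> eval (w ! i) b)}
    = {i. i < length w \<and> eval (w ! i) a} \<union> {i. i < length w \<and> eval (w ! i) b}"
    by auto
  then show ?case using Join by (simp add: PSC_def slabs_Un[OF u w])
qed

lemma slab_valuation_Eq:
  assumes u: "u \<bullet> u = 1" and w: "2 \<le> length w"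
  shows "holds PSC (slab_valuation u w) (a \<^bold>= b) \<longleftrightarrow> (\<forall>p\<in>set w. eval p a = eval p b)"
  using slabs_inj[OF u w, of "{i. i < length w \<and> eval (w ! i) a}"
      "{i. i < length w \<and> eval (w ! i) b}"]
  by (auto simp: trm_val_slab_valuation[OF u w] set_eq_iff all_set_conv_all_nth subset_iff)

lemma contact_rel_PSC: "contact_rel PSC = strong_contact"
  by (simp add: PSC_def)

text \<open>Adjacent slabs carry consecutive patterns of the walk, which are joined by an edge; every edge occurs
  in this way because the walk covers it.  A slab in contact with itself corresponds to a loop.\<close>

lemma slab_valuation_Con:
  assumes u: "u \<bullet> u = 1" and w: "2 \<le> length w"
    and R: "successively R w" "\<And>p q. R p q \<Longrightarrow> steps w p q" "\<And>p q. R p q \<Longrightarrow> R q p"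
      "\<And>p q. R p q \<Longrightarrow> R p p \<and> R q q"
  shows "holds PSC (slab_valuation u w) (Con a b) \<longleftrightarrow> (\<exists>p q. R p q \<and> eval p a \<and> eval q b)"
proof -
  let ?I = "\<lambda>a. {i. i < length w \<and> eval (w ! i) a}"
  have "holds PSC (slab_valuation u w) (Con a b)
      \<longleftrightarrow> (\<exists>i\<in>?I a. \<exists>j\<in>?I b. i \<le> Suc j \<and> j \<le> Suc i)"
    using strong_contact_slabs[OF u w, of "?I a" "?I b"]
    by (simp add: trm_val_slab_valuation[OF u w] contact_rel_PSC subset_iff)
  also have "\<dots> \<longleftrightarrow> (\<exists>p q. R p q \<and> eval p a \<and> eval q b)"
  proof
    assume "\<exists>i\<in>?I a. \<exists>j\<in>?I b. i \<le> Suc j \<and> j \<le> Suc i"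
    then obtain i j where ij: "i < length w" "eval (w ! i) a" "j < length w" "eval (w ! j) b"
      "i \<le> Suc j" "j \<le> Suc i" by auto
    consider "j = Suc i" | "i = Suc j" | "i = j" using ij(5,6) by linarith
    then have "R (w ! i) (w ! j)"
    proof cases
      case 1
      then show ?thesis using successively_nth[OF R(1), of i] ij by simp
    next
      case 2
      then show ?thesis using R(3)[OF successively_nth[OF R(1), of j]] ij by simp
    next
      case 3
      then show ?thesis using walk_loops[OF w R(1,4)] ij by simp
    qed
    then show "\<exists>p q. R p q \<and> eval p a \<and> eval q b" using ij by blast
  next
    assume "\<exists>p q. R p q \<and> eval p a \<and> eval q b"
    then obtain p q where "R p q" "eval p a" "eval q b" by blast
    moreover from R(2)[OF this(1)] obtain i where "Suc i < length w" "w ! i = p" "w ! Suc i = q"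
      by (auto simp: steps_def)
    ultimately show "\<exists>i\<in>?I a. \<exists>j\<in>?I b. i \<le> Suc j \<and> j \<le> Suc i"
      by (intro bexI[of _ i] bexI[of _ "Suc i"]) auto
  qed
  finally show ?thesis .
qed

primrec fm_vars :: "fm \<Rightarrow> nat list" where
  "fm_vars (a \<^bold>= b) = trm_vars a @ trm_vars b"
| "fm_vars (Con a b) = trm_vars a @ trm_vars b"
| "fm_vars (Neg A) = fm_vars A"
| "fm_vars (A \<^bold>\<or> B) = fm_vars A @ fm_vars B"

theorem theorem4p31:
  fixes \<phi> :: fm
  assumes "true_in (PSC :: (real ^ 'n) set contact_structure) \<phi>"
  shows "F_theorem \<phi>"
proof (rule ccontr)
  assume "\<not> F_theorem \<phi>"
  then obtain T where T: "complete_theory T" "\<phi> \<notin> T"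
    by (rule complete_theory_avoiding)
  then have closed: "closed_theory T" by (simp add: complete_theory_def)
  obtain u :: "real ^ 'n" where "u \<in> Basis" using nonempty_Basis by blast
  then have u: "u \<bullet> u = 1" by (simp add: inner_same_Basis)
  interpret contact_congruence "class_eq T" "class_con T"
    by (rule contact_congruence_theory[OF T(1)])
  define h where "h x = abs_term_class (Var x)" for x
  have h: "bval h a = abs_term_class a" for a
    using bval_abs[of a] by (simp add: h_def[abs_def])
  define xs where "xs = remdups (fm_vars \<phi>)"
  have xs: "distinct xs" "set (fm_vars \<phi>) \<subseteq> set xs" by (simp_all add: xs_def)
  obtain w where w: "2 \<le> length w" "successively (touch h xs) w"
    "\<And>p q. touch h xs p q \<Longrightarrow> steps w p q"
    using touch_walk[OF xs(1)] by blast
  have sym: "touch h xs q p" if "touch h xs p q" for p q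
    using that C_sym by (simp add: touch_def[OF xs(1)])
  note ends = touch_ends[OF xs(1)]
  have set_w: "set w = {p. touch h xs p p}"
    using walk_loops[OF w(1,2) ends] steps_in_set[OF w(3)] by blast
  have truth: "holds PSC (slab_valuation u w) A \<longleftrightarrow> A \<in> T" if "set (fm_vars A) \<subseteq> set xs" for A
    using that
  proof (induction A)
    case (Eq a b)
    then show ?case
      using eqv_iff_eval[OF xs(1), of a b h] slab_valuation_Eq[OF u w(1), of a b] set_w
      by (simp add: h class_eq_abs[OF closed])
  next
    case (Con a b)
    then have "class_con T (bval h a) (bval h b)
        \<longleftrightarrow> (\<exists>p q. touch h xs p q \<and> eval p a \<and> eval q b)"
      by (intro C_iff_eval[OF xs(1)]) auto
    moreover have "holds PSC (slab_valuation u w) (Con a b)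
        \<longleftrightarrow> (\<exists>p q. touch h xs p q \<and> eval p a \<and> eval q b)"
      by (rule slab_valuation_Con[OF u w sym ends])
    ultimately show ?case by (simp only: h class_con_abs[OF closed])
  qed (simp_all add: complete_theory_Neg[OF T(1)] complete_theory_Or[OF T(1)])
  have "slab_valuation u w x \<in> elems PSC" for x
    using slabs_polytope[OF u w(1)] by (simp add: slab_valuation_def PSC_def subset_iff)
  then have "holds PSC (slab_valuation u w) \<phi>"
    using assms by (simp add: true_in_def)
  then show False using truth[OF xs(2)] T(2) by blast
qed

end
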